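(* Max Slope Shift is consistent: fix $0<c<1$. For every mode $x_*$ of $f$ and every $x_0$ in the basin of attraction of $x_*$, there is $\varepsilon_0>0$ such that for all $\varepsilon\in(0,\varepsilon_0]$ the Max Slope Shift sequence with parameters $\varepsilon$ and $c$ initialized at $x_0$ converges to $x_*$.
   Context: Density. $f$ is a probability density on $\mathbb{R}^d$ with respect to Lebesgue measure such that: (i) $f(x)\to0$ as $\|x\|\to\infty$; (ii) $f$ is twice differentiable everywhere, and $f$, $\nabla f$, $\nabla^2 f$ are bounded and uniformly continuous; (iii) the Hessian $\nabla^2 f$ is non-singular at every critical point of $f$. A mode is a local maximum of $f$. Gradient flow. For $x\in\mathbb{R}^d$, $\gamma_x:[0,\infty)\to\mathbb{R}^d$ is the solution of $\gamma_x(0)=x$, $\dot\gamma_x(t)=\nabla f(\gamma_x(t))$; $\gamma_x(t)$ converges to a critical point of $f$ as $t\to\infty$, denoted $\gamma_x(\infty)$. The basin of attraction of $x_*$ is $\{x:\gamma_x(\infty)=x_*\}$. Max Slope Shift (regularized). Given $\varepsilon>0$, $0<c<1$ and a starting point $x_0$, define $x(0)=x_0$ and, for $k\ge0$: if $B(x(k),\varepsilon)$ contains a local maximum of $f$, then $x(k+1)$ is such a local maximum (and the process stops there); otherwise $$x(k+1)\in\operatorname*{arg\,max}_{x\in A(x(k),\varepsilon,c\varepsilon)}\frac{f(x)-f(x(k))}{\|x-x(k)\|},\qquad A(x,a,b):=\bar B(x,a)\setminus B(x,b),$$ where $B$ and $\bar B$ denote open and closed balls. Ties are broken in an arbitrary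 but deterministic way. A process that stops is said to converge to the point where it stops. *)

theory Defs
  imports "HOL-Analysis.Analysis"
begin

definition gradient :: "('a::euclidean_space \<Rightarrow> real) \<Rightarrow> 'a \<Rightarrow> 'a" where
  "gradient f x = (THE D. GDERIV f x :> D)"

text \<open>The Hessian as a bounded operator, so that boundedness and uniform continuity of
  \<^term>\<open>hessian f\<close> refer to the operator norm.\<close>

definition hessian :: "('a::euclidean_space \<Rightarrow> real) \<Rightarrow> 'a \<Rightarrow> 'a \<Rightarrow>\<^sub>L 'a" where
  "hessian f x = Blinfun (frechet_derivative (gradient f) (at x))"

definition twice_differentiable :: "('a::euclidean_space \<Rightarrow> real) \<Rightarrow> bool" where
  "twice_differentiable f \<longleftrightarrow>
     (\<forall>x. f differentiable (at x)) \<and> (\<forall>x. gradient f differentiable (at x))"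

definition critical_point :: "('a::euclidean_space \<Rightarrow> real) \<Rightarrow> 'a \<Rightarrow> bool" where
  "critical_point f x \<longleftrightarrow> gradient f x = 0"

definition probability_density :: "('a::euclidean_space \<Rightarrow> real) \<Rightarrow> bool" where
  "probability_density f \<longleftrightarrow>
     (\<forall>x. 0 \<le> f x) \<and> integrable lborel f \<and> integral\<^sup>L lborel f = 1"

definition is_local_max :: "('a::topological_space \<Rightarrow> real) \<Rightarrow> 'a \<Rightarrow> bool" where
  "is_local_max f x \<longleftrightarrow> (\<forall>\<^sub>F y in nhds x. f y \<le> f x)"

text \<open>Curves are functions on all of \<^typ>\<open>real\<close>, constrained on \<open>{0..}\<close> only; at time \<open>0\<close>
  the derivative is one-sided.\<close>

definition gradient_flow_line :: "('a::euclidean_space \<Rightarrow> real) \<Rightarrow> 'a \<Rightarrow> (real \<Rightarrow> 'a) \<Rightarrow> bool" where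
  "gradient_flow_line f x \<gamma> \<longleftrightarrow> \<gamma> 0 = x \<and>
     (\<forall>t\<ge>0. (\<gamma> has_vector_derivative gradient f (\<gamma> t)) (at t within {0..}))"

definition basin :: "('a::euclidean_space \<Rightarrow> real) \<Rightarrow> 'a \<Rightarrow> 'a set" where
  "basin f z = {x. \<exists>\<gamma>. gradient_flow_line f x \<gamma> \<and> (\<gamma> \<longlongrightarrow> z) at_top}"

definition annulus :: "'a::metric_space \<Rightarrow> real \<Rightarrow> real \<Rightarrow> 'a set" where
  "annulus x a b = cball x a - ball x b"

definition local_max_near :: "('a::metric_space \<Rightarrow> real) \<Rightarrow> real \<Rightarrow> 'a \<Rightarrow> bool" where
  "local_max_near f \<epsilon> x \<longleftrightarrow> (\<exists>y\<in>ball x \<epsilon>. is_local_max f y)"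

text \<open>An update map of Max Slope Shift: a function, defined at every point, that selects one
  of the admissible next points. Quantifying over such maps quantifies over all deterministic
  ways of breaking ties, both among the maximizers of the slope and among several local maxima
  in the ball.\<close>

definition max_slope_shift_map ::
    "('a::euclidean_space \<Rightarrow> real) \<Rightarrow> real \<Rightarrow> real \<Rightarrow> ('a \<Rightarrow> 'a) \<Rightarrow> bool" where
  "max_slope_shift_map f \<epsilon> c S \<longleftrightarrow>
     (\<forall>x. if local_max_near f \<epsilon> x
          then S x \<in> ball x \<epsilon> \<and> is_local_max f (S x)
          else is_arg_max (\<lambda>y. (f y - f x) / norm (y - x)) (\<lambda>y. y \<in> annulus x \<epsilon> (c * \<epsilon>)) (S x))"

text \<open>The iterates form an infinite sequence, but the process stops at index \<open>Suc k\<close> for the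
  first \<open>k\<close> whose ball contains a local maximum; later iterates are disregarded.\<close>

definition max_slope_shift_converges ::
    "('a::euclidean_space \<Rightarrow> real) \<Rightarrow> real \<Rightarrow> ('a \<Rightarrow> 'a) \<Rightarrow> 'a \<Rightarrow> 'a \<Rightarrow> bool" where
  "max_slope_shift_converges f \<epsilon> S x0 z \<longleftrightarrow>
     (\<exists>k. (\<forall>j<k. \<not> local_max_near f \<epsilon> ((S ^^ j) x0)) \<and>
          local_max_near f \<epsilon> ((S ^^ k) x0) \<and> (S ^^ Suc k) x0 = z)"

end

theory Submission
  imports Defs
begin

text \<open>
  The proof splits the trajectory into a transport phase, in which the shift follows the gradient
  flow line \<open>\<gamma>\<close> of the starting point, and a capture phase near the mode \<open>x\<^sub>*\<close>.

  Transport. Let \<open>L\<close> be a Lipschitz constant and \<open>M\<close> a bound of the gradient. Up to an error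
  \<open>L \<epsilon>\<close>, the slope from \<open>x\<close> in the unit direction \<open>u\<close> is \<open>\<nabla>f(x) \<bullet> u\<close>. Where the gradient has norm at
  least \<open>m\<close>, the direction of steepest slope is thus within \<open>O(\<surd>\<epsilon>)\<close> of the normalized gradient, and one
  step is an Euler step of the flow whose duration \<open>\<tau>\<close> is the step length divided by
  \<open>\<parallel>\<nabla>f(x)\<parallel>\<close> (\<open>shift_euler\<close>). Since the step length is at least \<open>c \<epsilon>\<close>, each step advances the clock
  by at least \<open>c \<epsilon> / M\<close>, and a discrete Gronwall estimate shows that the shift arrives near \<open>\<gamma> T\<close>
  for any given \<open>T\<close> once \<open>\<epsilon>\<close> is small (\<open>shift_tracks_flow\<close>). A flow line that does not start at a
  critical point never meets one, so the gradient is bounded away from \<open>0\<close> on a tube around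
  \<open>\<gamma> ` {0..T}\<close>; for the same reason no local maximum stops the shift prematurely.

  Capture. The Taylor comparison is useless at distances comparable to \<open>\<epsilon>\<close> from \<open>x\<^sub>*\<close>, where the
  gradient is itself of order \<open>\<epsilon>\<close>. There a softer argument applies: if no point of the annulus were
  higher than \<open>x\<close>, then the maximum of \<open>f\<close> over the closed \<open>\<epsilon>\<close>-ball would be attained in the open
  ball and would be a local maximum there. Hence a step that does not stop always ascends
  (\<open>shift_ascends\<close>), and by compactness an orbit that stays bounded cannot ascend forever
  (\<open>bounded_orbit_meets_local_max\<close>). The non-singular Hessian makes \<open>x\<^sub>*\<close> an isolated critical
  point, hence a strict maximum, and a superlevel set of \<open>f\<close> around it traps the ascending shift,
  which can then stop only at \<open>x\<^sub>*\<close> (\<open>trapping_neighbourhood\<close>).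
\<close>

section \<open>Ascent of the shift away from local maxima\<close>

lemma local_max_near_dest:
  assumes "max_slope_shift_map f \<epsilon> c S" "local_max_near f \<epsilon> x"
  shows "S x \<in> ball x \<epsilon>" "is_local_max f (S x)"
  using assms unfolding max_slope_shift_map_def by meson+

lemma shift_step:
  assumes S: "max_slope_shift_map f \<epsilon> c S" and "\<not> local_max_near f \<epsilon> x"
  shows "c * \<epsilon> \<le> norm (S x - x)" "norm (S x - x) \<le> \<epsilon>"
    and "\<And>y. c * \<epsilon> \<le> norm (y - x) \<Longrightarrow> norm (y - x) \<le> \<epsilon> \<Longrightarrow>
           (f y - f x) / norm (y - x) \<le> (f (S x) - f x) / norm (S x - x)"
proof -
  have *: "is_arg_max (\<lambda>y. (f y - f x) / norm (y - x)) (\<lambda>y. y \<in> annulus x \<epsilon> (c * \<epsilon>)) (S x)"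
    using assms unfolding max_slope_shift_map_def by meson
  show "c * \<epsilon> \<le> norm (S x - x)" "norm (S x - x) \<le> \<epsilon>"
    using * by (auto simp: is_arg_max_def annulus_def dist_norm norm_minus_commute)
  fix y assume "c * \<epsilon> \<le> norm (y - x)" "norm (y - x) \<le> \<epsilon>"
  then have "y \<in> annulus x \<epsilon> (c * \<epsilon>)"
    by (auto simp: annulus_def dist_norm norm_minus_commute)
  then show "(f y - f x) / norm (y - x) \<le> (f (S x) - f x) / norm (S x - x)"
    using * by (auto simp: is_arg_max_def not_less)
qed

text \<open>If the annulus contained no higher point, then a maximizer of \<open>f\<close> over the closed ball could be
  found in the open ball: either it lies there already, or it lies on the sphere, hence in the
  annulus, and then the centre is as high.\<close>

lemma shift_ascends:
  fixes f :: "'a::euclidean_space \<Rightarrow> real"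
  assumes S: "max_slope_shift_map f \<epsilon> c S" and nn: "\<not> local_max_near f \<epsilon> x"
    and cont: "continuous_on UNIV f" and \<epsilon>: "0 < \<epsilon>" and c: "0 < c" "c < 1"
  shows "f x < f (S x)"
proof (rule ccontr)
  assume "\<not> f x < f (S x)"
  have out: "f y \<le> f x" if "c * \<epsilon> \<le> norm (y - x)" "norm (y - x) \<le> \<epsilon>" for y
  proof -
    have "(f y - f x) / norm (y - x) \<le> (f (S x) - f x) / norm (S x - x)"
      using shift_step(3)[OF S nn that] .
    also have "\<dots> \<le> 0" using \<open>\<not> f x < f (S x)\<close> by (simp add: divide_nonpos_nonneg)
    finally show ?thesis
      using that \<epsilon> c by (smt (verit) divide_pos_pos mult_pos_pos)
  qed
  have "compact (cball x \<epsilon>)" "cball x \<epsilon> \<noteq> {}" "continuous_on (cball x \<epsilon>) f"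
    using \<epsilon> cont by (auto intro: continuous_on_subset)
  then obtain z where z: "z \<in> cball x \<epsilon>" "\<And>y. y \<in> cball x \<epsilon> \<Longrightarrow> f y \<le> f z"
    using continuous_attains_sup by metis
  obtain w where w: "w \<in> ball x \<epsilon>" "\<And>y. y \<in> cball x \<epsilon> \<Longrightarrow> f y \<le> f w"
  proof (cases "norm (z - x) < \<epsilon>")
    case True
    then show ?thesis using that z by (simp add: dist_norm norm_minus_commute)
  next
    case False
    have "c * \<epsilon> \<le> \<epsilon>" using c \<epsilon> by (simp add: mult_le_cancel_right1)
    then have "f z \<le> f x"
      using False z(1) out[of z] by (simp add: dist_norm norm_minus_commute)
    then show ?thesis using that[of x] z(2) \<epsilon> by (metis centre_in_ball order_trans)
  qed
  have "is_local_max f w" unfolding is_local_max_def eventually_nhds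
    using w by (intro exI[of _ "ball x \<epsilon>"]) auto
  with w(1) nn show False unfolding local_max_near_def by blast
qed

text \<open>Maximizing the slope rather than the gain costs at most the ratio \<open>c\<close> of the shortest to the
  longest admissible step. Unlike the strict ascent, this bound survives a passage to the limit
  in \<open>x\<close>.\<close>

lemma shift_gain:
  fixes f :: "'a::euclidean_space \<Rightarrow> real"
  assumes S: "max_slope_shift_map f \<epsilon> c S" and nn: "\<not> local_max_near f \<epsilon> x"
    and cont: "continuous_on UNIV f" and \<epsilon>: "0 < \<epsilon>" and c: "0 < c" "c < 1"
    and y: "c * \<epsilon> \<le> norm (y - x)" "norm (y - x) \<le> \<epsilon>"
  shows "c * (f y - f x) \<le> f (S x) - f x"
proof (cases "f y \<le> f x")
  case True
  then have "c * (f y - f x) \<le> 0" using c by (simp add: mult_le_0_iff)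
  then show ?thesis using shift_ascends[OF S nn cont \<epsilon> c] by simp
next
  case False
  note st = shift_step[OF S nn]
  have ce: "0 < c * \<epsilon>" using c \<epsilon> by simp
  have "c * norm (y - x) \<le> norm (S x - x)"
    using st(1) y(2) c by (smt (verit) mult_left_mono)
  then have "c * (f y - f x) = c * norm (y - x) * ((f y - f x) / norm (y - x))"
    using y ce by auto
  also have "\<dots> \<le> norm (S x - x) * ((f y - f x) / norm (y - x))"
    using False \<open>c * norm (y - x) \<le> norm (S x - x)\<close> by (intro mult_right_mono) auto
  also have "\<dots> \<le> norm (S x - x) * ((f (S x) - f x) / norm (S x - x))"
    using st(3)[OF y] by (intro mult_left_mono) auto
  also have "\<dots> = f (S x) - f x" using st(1) ce by auto
  finally show ?thesis .
qed

text \<open>Otherwise the values increase to the value at an accumulation point \<open>p\<close>, so the gains tend to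
  \<open>0\<close>. Having a local maximum in the open ball is an open condition on the centre, hence there is none
  near \<open>p\<close>, and some admissible displacement \<open>q - p\<close> from \<open>p\<close> leads upwards. The same displacement is
  admissible at the iterates close to \<open>p\<close> and forces gains bounded away from \<open>0\<close>.\<close>

lemma bounded_orbit_meets_local_max:
  fixes f :: "'a::euclidean_space \<Rightarrow> real"
  assumes S: "max_slope_shift_map f \<epsilon> c S"
    and cont: "continuous_on UNIV f" and \<epsilon>: "0 < \<epsilon>" and c: "0 < c" "c < 1"
    and bd: "bounded (range (\<lambda>n. (S ^^ n) x))"
  shows "\<exists>n. local_max_near f \<epsilon> ((S ^^ n) x)"
proof (rule ccontr)
  assume no: "\<not> ?thesis"
  define X where "X n = (S ^^ n) x" for n
  have nn: "\<not> local_max_near f \<epsilon> (X n)" for n using no by (auto simp: X_def)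
  have Suc: "X (Suc n) = S (X n)" for n by (simp add: X_def)
  have "compact (closure (range X))" using bd by (simp add: X_def[abs_def])
  moreover have "\<forall>n. X n \<in> closure (range X)" by (simp add: closure_subset[THEN subsetD])
  ultimately obtain p r where r: "strict_mono r" "(X \<circ> r) \<longlonglongrightarrow> p"
    unfolding compact_def by metis
  have fc: "isCont f z" for z using cont by (simp add: continuous_on_eq_continuous_at)
  have nnp: "\<not> local_max_near f \<epsilon> p"
  proof
    assume "local_max_near f \<epsilon> p"
    then obtain y where y: "dist p y < \<epsilon>" "is_local_max f y" by (auto simp: local_max_near_def)
    have "(\<lambda>n. dist ((X \<circ> r) n) y) \<longlonglongrightarrow> dist p y" by (intro tendsto_intros r)
    then have "\<forall>\<^sub>F n in sequentially. dist ((X \<circ> r) n) y < \<epsilon>"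
      using y(1) by (rule order_tendstoD)
    then obtain n where "dist (X (r n)) y < \<epsilon>" by (auto simp: eventually_sequentially)
    with y nn[of "r n"] show False by (auto simp: local_max_near_def)
  qed
  define q where "q = S p"
  have q: "f p < f q" unfolding q_def by (rule shift_ascends[OF S nnp cont \<epsilon> c])
  have gain: "c * (f (X (r n) + (q - p)) - f (X (r n))) \<le> f (X (Suc (r n))) - f (X (r n))" for n
    using shift_gain[OF S nn cont \<epsilon> c, of "X (r n) + (q - p)" "r n"] shift_step[OF S nnp]
    by (simp add: q_def Suc)
  have inc: "incseq (\<lambda>n. f (X n))"
    by (rule incseq_SucI) (use shift_ascends[OF S nn cont \<epsilon> c] Suc less_imp_le in metis)
  have lim: "(\<lambda>n. f (X (r n))) \<longlonglongrightarrow> f p"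
    using isCont_tendsto_compose[OF fc r(2)] by (simp add: o_def)
  have le: "f (X n) \<le> f p" for n
  proof -
    have "incseq (\<lambda>n. f (X (r n)))"
      using inc r(1) by (auto simp: incseq_def strict_mono_less_eq)
    then have "f (X (r n)) \<le> f p" using lim by (rule incseq_le)
    moreover have "f (X n) \<le> f (X (r n))" using inc r(1) seq_suble by (auto simp: incseq_def)
    ultimately show ?thesis by simp
  qed
  have "(\<lambda>n. c * (f (X (r n) + (q - p)) - f (X (r n)))) \<longlonglongrightarrow> c * (f (p + (q - p)) - f p)"
    using r(2) by (intro tendsto_intros lim isCont_tendsto_compose[OF fc]) (simp add: o_def)
  moreover have "(\<lambda>n. f p - f (X (r n))) \<longlonglongrightarrow> f p - f p" by (intro tendsto_intros lim)
  moreover have "c * (f (X (r n) + (q - p)) - f (X (r n))) \<le> f p - f (X (r n))" for n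
    using gain[of n] le[of "Suc (r n)"] by simp
  ultimately have "c * (f (p + (q - p)) - f p) \<le> f p - f p"
    by (intro LIMSEQ_le) auto
  with q c show False by (simp add: mult_le_0_iff)
qed

section \<open>Functions with bounded and Lipschitz gradient\<close>

locale lipschitz_gradient =
  fixes f :: "'a::euclidean_space \<Rightarrow> real" and L M :: real
  assumes has_gradient: "(f has_derivative (\<lambda>h. h \<bullet> gradient f x)) (at x)"
    and lip: "norm (gradient f x - gradient f y) \<le> L * norm (x - y)"
    and grad_le: "norm (gradient f x) \<le> M"
    and L_pos: "0 < L" and M_pos: "0 < M"
begin

lemma continuous_f: "continuous_on UNIV f"
  unfolding continuous_on_eq_continuous_at[OF open_UNIV]
  using has_derivative_continuous[OF has_gradient] by blast

lemma local_max_critical: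
  assumes "is_local_max f x" shows "gradient f x = 0"
proof -
  have "(\<lambda>h. h \<bullet> gradient f x) = (\<lambda>h. 0)"
    using assms by (intro has_derivative_local_max[OF has_gradient])
      (simp add: is_local_max_def eventually_nhds_conv_at)
  then show ?thesis by (metis inner_eq_zero_iff)
qed

lemma linearization: "\<bar>f y - f x - (y - x) \<bullet> gradient f x\<bar> \<le> L * (norm (y - x))\<^sup>2"
proof -
  have "norm (f y - f x - (y - x) \<bullet> gradient f x) \<le> norm (y - x) * (L * norm (y - x))"
  proof (rule differentiable_bound_linearization[where S = "closed_segment x y"
        and f' = "\<lambda>z h. h \<bullet> gradient f z"])
    show "(f has_derivative (\<lambda>h. h \<bullet> gradient f z)) (at z within closed_segment x y)" for z
      by (rule has_derivative_at_withinI[OF has_gradient])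
    fix z assume z: "z \<in> closed_segment x y"
    have "norm (z - x) \<le> norm (y - x)"
      using segment_bound[OF z] by (simp add: norm_minus_commute)
    then have "norm (gradient f z - gradient f x) \<le> L * norm (y - x)"
      using lip[of z x] L_pos by (smt (verit) mult_left_mono)
    then have "\<bar>h \<bullet> (gradient f z - gradient f x)\<bar> \<le> L * norm (y - x) * norm h" for h
      using Cauchy_Schwarz_ineq2[of h "gradient f z - gradient f x"]
      by (smt (verit) mult.commute mult_left_mono norm_ge_zero)
    then show "onorm ((\<lambda>h. h \<bullet> gradient f z) - (\<lambda>h. h \<bullet> gradient f x)) \<le> L * norm (y - x)"
      by (intro onorm_le) (simp add: inner_diff_right)
  next
    fix t :: real assume "t \<in> {0..1}"
    then show "x + t *\<^sub>R (y - x) \<in> closed_segment x y"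
      unfolding closed_segment_def by (auto intro!: exI[of _ t] simp: algebra_simps)
  qed auto
  then show ?thesis by (simp add: power2_eq_square mult_ac)
qed

lemma slope_deviation:
  assumes "y \<noteq> x"
  shows "\<bar>(f y - f x) / norm (y - x) - (y - x) \<bullet> gradient f x / norm (y - x)\<bar> \<le> L * norm (y - x)"
proof -
  have "\<bar>(f y - f x) / norm (y - x) - (y - x) \<bullet> gradient f x / norm (y - x)\<bar>
      = \<bar>f y - f x - (y - x) \<bullet> gradient f x\<bar> / norm (y - x)"
    by (simp add: diff_divide_distrib[symmetric])
  also have "\<dots> \<le> L * (norm (y - x))\<^sup>2 / norm (y - x)"
    by (intro divide_right_mono linearization) simp
  also have "\<dots> = L * norm (y - x)" using assms by (simp add: power2_eq_square)
  finally show ?thesis .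
qed

text \<open>The neighbourhood \<open>U\<close> consists of the points of a ball of radius \<open>r\<close> whose value exceeds all values on
  the shell of radii \<open>r\<close> and \<open>2 r\<close>. An ascending step of length at most \<open>r\<close> cannot cross
  the shell, and it cannot land in it.\<close>

lemma trapping_neighbourhood:
  assumes xs: "is_local_max f xs"
    and iso: "\<forall>\<^sub>F x in at xs. gradient f x \<noteq> 0" and c: "0 < c" "c < 1"
  obtains U e where "open U" "xs \<in> U" "0 < e"
    "\<And>\<epsilon> S x. 0 < \<epsilon> \<Longrightarrow> \<epsilon> \<le> e \<Longrightarrow> max_slope_shift_map f \<epsilon> c S \<Longrightarrow> x \<in> U \<Longrightarrow>
       max_slope_shift_converges f \<epsilon> S x xs"
proof -
  have "\<forall>\<^sub>F x in nhds xs. x \<noteq> xs \<longrightarrow> gradient f x \<noteq> 0"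
    using iso by (simp add: eventually_at_filter)
  with xs have "\<forall>\<^sub>F x in nhds xs. f x \<le> f xs \<and> (x \<noteq> xs \<longrightarrow> gradient f x \<noteq> 0)"
    unfolding is_local_max_def by (rule eventually_conj)
  then obtain R where R: "0 < R" "\<And>x. dist x xs < R \<Longrightarrow> f x \<le> f xs"
      "\<And>x. dist x xs < R \<Longrightarrow> x \<noteq> xs \<Longrightarrow> gradient f x \<noteq> 0"
    unfolding eventually_nhds_metric by blast
  (* Within distance 2 r < R of xs, steps of length up to r stay in the region without further
     critical points. *)
  define r where "r = R / 3"
  have r: "0 < r" "2 * r < R" using R(1) by (auto simp: r_def)
  have strict: "f x < f xs" if "dist x xs < R" "x \<noteq> xs" for x
  proof (rule ccontr)
    assume "\<not> f x < f xs"
    then have "\<And>y. y \<in> ball xs R \<Longrightarrow> f y \<le> f x" using R(2) by (fastforce simp: dist_commute)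
    then have "is_local_max f x" unfolding is_local_max_def eventually_nhds
      using that by (intro exI[of _ "ball xs R"]) (auto simp: dist_commute)
    then show False using local_max_critical R(3) that by blast
  qed
  define A where "A = cball xs (2 * r) - ball xs r"
  obtain a where a: "a < f xs" "\<And>x. x \<in> A \<Longrightarrow> f x \<le> a"
  proof (cases "A = {}")
    case True
    then show ?thesis using that[of "f xs - 1"] by simp
  next
    case False
    have "compact A" unfolding A_def by (intro compact_diff) auto
    then obtain z where z: "z \<in> A" "\<And>y. y \<in> A \<Longrightarrow> f y \<le> f z"
      using continuous_attains_sup[OF _ False] continuous_f continuous_on_subset by blast
    have "f z < f xs" using z(1) r by (intro strict) (auto simp: A_def dist_commute)
    then show ?thesis using that z by blast
  qed
  define U where "U = ball xs r \<inter> {x. a < f x}"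
  show ?thesis
  proof
    show "open U" unfolding U_def
      by (intro open_Int open_ball open_Collect_less continuous_on_const continuous_f)
    show "xs \<in> U" using r a by (simp add: U_def)
    show "0 < r" by fact
    fix \<epsilon> S x assume \<epsilon>: "0 < \<epsilon>" "\<epsilon> \<le> r" and S: "max_slope_shift_map f \<epsilon> c S" and x: "x \<in> U"
    have stay: "S y \<in> U" if y: "y \<in> U" and nn: "\<not> local_max_near f \<epsilon> y" for y
    proof -
      have "f y < f (S y)" by (rule shift_ascends[OF S nn continuous_f \<epsilon>(1) c])
      then have "a < f (S y)" using y by (simp add: U_def)
      have "dist xs (S y) \<le> dist xs y + dist y (S y)" by (rule dist_triangle)
      also have "\<dots> < 2 * r" using shift_step(2)[OF S nn] \<epsilon> y
        by (simp add: U_def dist_norm norm_minus_commute)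
      finally have "S y \<in> ball xs r"
        using a(2)[of "S y"] \<open>a < f (S y)\<close> by (force simp: A_def)
      then show ?thesis using \<open>a < f (S y)\<close> by (simp add: U_def)
    qed
    have orbit: "(S ^^ n) x \<in> U" if "\<forall>j<n. \<not> local_max_near f \<epsilon> ((S ^^ j) x)" for n
      using that by (induction n) (auto intro: x stay)
    have "\<exists>n. local_max_near f \<epsilon> ((S ^^ n) x)"
    proof (rule ccontr)
      assume no: "\<not> ?thesis"
      then have "range (\<lambda>n. (S ^^ n) x) \<subseteq> ball xs r" using orbit by (auto simp: U_def)
      then have "bounded (range (\<lambda>n. (S ^^ n) x))" using bounded_ball bounded_subset by blast
      then show False using bounded_orbit_meets_local_max[OF S continuous_f \<epsilon>(1) c] no by blast
    qed
    then obtain k where k: "local_max_near f \<epsilon> ((S ^^ k) x)"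
        "\<forall>j<k. \<not> local_max_near f \<epsilon> ((S ^^ j) x)"
      using exists_least_iff[of "\<lambda>n. local_max_near f \<epsilon> ((S ^^ n) x)"] by blast
    define y where "y = (S ^^ k) x"
    have y: "y \<in> U" using orbit k(2) by (simp add: y_def)
    have Sy: "dist y (S y) < \<epsilon>" "is_local_max f (S y)"
      using local_max_near_dest[OF S k(1)] by (auto simp: y_def)
    have "dist xs (S y) \<le> dist xs y + dist y (S y)" by (rule dist_triangle)
    also have "\<dots> < R" using Sy y \<epsilon> r by (simp add: U_def)
    finally have "S y = xs" using R(3)[of "S y"] local_max_critical[OF Sy(2)]
      by (auto simp: dist_commute)
    then show "max_slope_shift_converges f \<epsilon> S x xs"
      unfolding max_slope_shift_converges_def using k by (auto simp: y_def)
  qed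
qed


section \<open>Gradient flow lines\<close>

text \<open>Uniqueness of the flow through a critical point \<open>p\<close>: the squared distance \<open>\<phi>\<close> to \<open>p\<close>
  satisfies \<open>\<bar>\<phi>'\<bar> \<le> 2 L \<phi>\<close>, so \<open>\<phi>(t) exp(2 L t)\<close> is nondecreasing and
  \<open>\<phi>(t) exp(-2 L t)\<close> is nonincreasing; the first forces \<open>\<phi>\<close> to vanish before a zero and the second
  after it.\<close>

lemma flow_line_at_critical_point:
  assumes flow: "gradient_flow_line f x \<gamma>" and t1: "0 \<le> t1" "gradient f (\<gamma> t1) = 0" and t: "0 \<le> t"
  shows "\<gamma> t = \<gamma> t1"
proof -
  define p where "p = \<gamma> t1"
  define \<phi> where "\<phi> s = (\<gamma> s - p) \<bullet> (\<gamma> s - p)" for s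
  define d where "d s = 2 * ((\<gamma> s - p) \<bullet> gradient f (\<gamma> s))" for s
  have der: "(\<gamma> has_vector_derivative gradient f (\<gamma> s)) (at s within {0..})" if "0 \<le> s" for s
    using flow that unfolding gradient_flow_line_def by blast
  have d\<phi>: "(\<phi> has_real_derivative d s) (at s within {0..})" if "0 \<le> s" for s
    unfolding \<phi>_def d_def has_field_derivative_def
    by (rule derivative_eq_intros der[OF that, unfolded has_vector_derivative_def] refl)+
      (simp add: fun_eq_iff inner_commute)
  have d_le: "\<bar>d s\<bar> \<le> 2 * L * \<phi> s" for s
  proof -
    have "\<bar>(\<gamma> s - p) \<bullet> gradient f (\<gamma> s)\<bar> \<le> norm (\<gamma> s - p) * norm (gradient f (\<gamma> s))"
      by (rule Cauchy_Schwarz_ineq2)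
    also have "\<dots> \<le> norm (\<gamma> s - p) * (L * norm (\<gamma> s - p))"
      using lip[of "\<gamma> s" p] t1(2) by (intro mult_left_mono) (simp_all add: p_def)
    finally show ?thesis
      by (simp add: d_def \<phi>_def power2_norm_eq_inner[symmetric] power2_eq_square abs_mult mult_ac)
  qed
  (* The sign K = 1 or K = -1 selects one of the two monotone quantities. *)
  have mono: "K * (\<phi> a * exp (K * 2 * L * a)) \<le> K * (\<phi> b * exp (K * 2 * L * b))"
    if "0 \<le> a" "a \<le> b" "\<bar>K\<bar> = 1" for K a b
  proof (rule DERIV_nonneg_imp_increasing_open[OF \<open>a \<le> b\<close>])
    define D where "D s = K * (d s * exp (K * 2 * L * s) + \<phi> s * (exp (K * 2 * L * s) * (K * 2 * L)))" for s
    have D: "((\<lambda>s. K * (\<phi> s * exp (K * 2 * L * s))) has_real_derivative D s) (at s within {0..})"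
      if "0 \<le> s" for s
      unfolding D_def by (rule derivative_eq_intros d\<phi>[OF that] refl)+ simp
    show "continuous_on {a..b} (\<lambda>s. K * (\<phi> s * exp (K * 2 * L * s)))"
      using \<open>0 \<le> a\<close> by (intro DERIV_continuous_on[OF DERIV_subset[OF D]]) auto
    fix s assume s: "a < s" "s < b"
    have "0 \<le> D s"
    proof -
      have "K * K = 1" using \<open>\<bar>K\<bar> = 1\<close> by (metis abs_mult_self_eq mult_1)
      moreover have "D s = (K * d s + (K * K) * (2 * L * \<phi> s)) * exp (K * 2 * L * s)"
        by (simp add: D_def algebra_simps)
      moreover have "\<bar>K * d s\<bar> \<le> 2 * L * \<phi> s" using d_le[of s] \<open>\<bar>K\<bar> = 1\<close> by (simp add: abs_mult)
      ultimately show ?thesis by simp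
    qed
    moreover have "at s within {0..} = at s"
      using s \<open>0 \<le> a\<close> by (intro at_within_interior) simp
    ultimately show "\<exists>y. ((\<lambda>s. K * (\<phi> s * exp (K * 2 * L * s))) has_real_derivative y) (at s) \<and> 0 \<le> y"
      using D[of s] s \<open>0 \<le> a\<close> by auto
  qed
  have "\<phi> t1 = 0" by (simp add: \<phi>_def p_def)
  have "\<phi> t \<le> 0"
  proof (cases "t \<le> t1")
    case True
    then show ?thesis using mono[OF t, of t1 1] \<open>\<phi> t1 = 0\<close> by (simp add: mult_le_0_iff)
  next
    case False
    then show ?thesis using mono[OF t1(1), of t "-1"] \<open>\<phi> t1 = 0\<close>
      by (simp add: zero_le_mult_iff mult_le_0_iff)
  qed
  then have "(\<gamma> t - p) \<bullet> (\<gamma> t - p) = 0"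
    unfolding \<phi>_def using inner_ge_zero[of "\<gamma> t - p"] by linarith
  then show ?thesis unfolding inner_eq_zero_iff p_def by simp
qed

lemma flow_line_lipschitz:
  assumes flow: "gradient_flow_line f x \<gamma>" and "0 \<le> s" "0 \<le> t"
  shows "norm (\<gamma> s - \<gamma> t) \<le> M * \<bar>s - t\<bar>"
proof -
  have "norm (\<gamma> s - \<gamma> t) \<le> M * norm (s - t)"
  proof (rule differentiable_bound[where S = "{0..}" and f' = "\<lambda>r h. h *\<^sub>R gradient f (\<gamma> r)"])
    show "(\<gamma> has_derivative (\<lambda>h. h *\<^sub>R gradient f (\<gamma> r))) (at r within {0..})" if "r \<in> {0..}" for r
      using flow that by (simp add: gradient_flow_line_def has_vector_derivative_def)
    show "onorm (\<lambda>h. h *\<^sub>R gradient f (\<gamma> r)) \<le> M" for r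
      by (rule onorm_le) (use mult_right_mono[OF grad_le[of "\<gamma> r"] abs_ge_zero] in \<open>simp add: mult.commute\<close>)
  qed (use assms in auto)
  then show ?thesis by simp
qed

lemma flow_line_euler:
  assumes flow: "gradient_flow_line f x \<gamma>" and "0 \<le> t" "0 \<le> \<tau>"
  shows "norm (\<gamma> (t + \<tau>) - \<gamma> t - \<tau> *\<^sub>R gradient f (\<gamma> t)) \<le> L * M * \<tau>\<^sup>2"
proof -
  have "norm (\<gamma> (t + \<tau>) - \<gamma> t - ((t + \<tau>) - t) *\<^sub>R gradient f (\<gamma> t)) \<le> norm ((t + \<tau>) - t) * (L * (M * \<tau>))"
  proof (rule vector_differentiable_bound_linearization[where S = "{t..t + \<tau>}" and
        f' = "\<lambda>r. gradient f (\<gamma> r)"])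
    fix r assume r: "r \<in> {t..t + \<tau>}"
    have "(\<gamma> has_vector_derivative gradient f (\<gamma> r)) (at r within {0..})"
      using flow r \<open>0 \<le> t\<close> unfolding gradient_flow_line_def by auto
    then show "(\<gamma> has_vector_derivative gradient f (\<gamma> r)) (at r within {t..t + \<tau>})"
      by (rule has_vector_derivative_within_subset) (use \<open>0 \<le> t\<close> in auto)
    have "norm (\<gamma> r - \<gamma> t) \<le> M * \<bar>r - t\<bar>" 
      by (rule flow_line_lipschitz[OF flow]) (use r \<open>0 \<le> t\<close> in auto)
    also have "\<dots> \<le> M * \<tau>" using r M_pos by (intro mult_left_mono) auto
    finally have "L * norm (\<gamma> r - \<gamma> t) \<le> L * (M * \<tau>)" using L_pos by simp
    then show "norm (gradient f (\<gamma> r) - gradient f (\<gamma> t)) \<le> L * (M * \<tau>)"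
      using lip order_trans by blast
  qed (use \<open>0 \<le> \<tau>\<close> in \<open>auto simp: closed_segment_eq_real_ivl\<close>)
  then show ?thesis using \<open>0 \<le> \<tau>\<close> by (simp add: power2_eq_square mult_ac)
qed

section \<open>Tracking the flow\<close>

text \<open>Comparison of the chosen slope with that of the step of length \<open>\<epsilon>\<close> along the normalized
  gradient \<open>v\<close> gives \<open>\<nabla>f(x) \<bullet> u \<ge> \<parallel>\<nabla>f(x)\<parallel> - 2 L \<epsilon>\<close> for the chosen direction \<open>u\<close>. As
  \<open>\<parallel>u - v\<parallel>\<^sup>2 = 2 (1 - u \<bullet> v)\<close>, the directions differ by at most \<open>\<surd>(4 L \<epsilon> / m)\<close>.\<close>

lemma shift_euler:
  fixes S x
  defines "\<tau> \<equiv> norm (S x - x) / norm (gradient f x)"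
  assumes S: "max_slope_shift_map f \<epsilon> c S" and nn: "\<not> local_max_near f \<epsilon> x"
    and \<epsilon>: "0 < \<epsilon>" and c: "0 < c" "c < 1" and m: "0 < m" "m \<le> norm (gradient f x)"
  shows "norm (S x - x - \<tau> *\<^sub>R gradient f x) \<le> \<tau> * (M * sqrt (4 * L * \<epsilon> / m))"
    and "c * \<epsilon> / M \<le> \<tau>" and "\<tau> \<le> \<epsilon> / m"
proof -
  define g s where "g = gradient f x" and "s = norm (S x - x)"
  have g: "0 < norm g" "m \<le> norm g" "norm g \<le> M" using m grad_le by (auto simp: g_def)
  note st = shift_step[OF S nn]
  have s: "c * \<epsilon> \<le> s" "s \<le> \<epsilon>" using st by (auto simp: s_def)
  have "0 < c * \<epsilon>" using c \<epsilon> by simp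
  with s have s0: "0 < s" by simp
  have \<tau>: "\<tau> = s / norm g" by (simp add: \<tau>_def s_def g_def)
  show "c * \<epsilon> / M \<le> \<tau>" unfolding \<tau> using s g s0 by (intro frac_le) auto
  show "\<tau> \<le> \<epsilon> / m" unfolding \<tau> using s g s0 m by (intro frac_le) auto
  define u v where "u = (1 / s) *\<^sub>R (S x - x)" and "v = (1 / norm g) *\<^sub>R g"
  have uv: "norm u = 1" "norm v = 1" using s0 g by (auto simp: u_def v_def s_def)
  have "norm g - L * \<epsilon> \<le> (f (x + \<epsilon> *\<^sub>R v) - f x) / norm (x + \<epsilon> *\<^sub>R v - x)"
  proof -
    have "v \<bullet> g = norm g"
      using g by (simp add: v_def power2_norm_eq_inner[symmetric] power2_eq_square)
    then show ?thesis
      using slope_deviation[of "x + \<epsilon> *\<^sub>R v" x] uv \<epsilon> by (force simp: g_def[symmetric])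
  qed
  also have "\<dots> \<le> (f (S x) - f x) / s"
    unfolding s_def using st(3)[of "x + \<epsilon> *\<^sub>R v"] uv \<epsilon> c by (simp add: mult_le_cancel_right1)
  also have "\<dots> \<le> u \<bullet> g + L * s"
    using slope_deviation[of "S x" x] s0 by (simp add: u_def s_def g_def)
  also have "\<dots> \<le> u \<bullet> g + L * \<epsilon>" using s L_pos by simp
  finally have "norm g - u \<bullet> g \<le> 2 * L * \<epsilon>" by simp
  then have "(norm g - u \<bullet> g) / norm g \<le> 2 * L * \<epsilon> / m"
    using g m L_pos \<epsilon> by (intro frac_le) auto
  moreover have "u \<bullet> v = u \<bullet> g / norm g" by (simp add: v_def)
  ultimately have "1 - u \<bullet> v \<le> 2 * L * \<epsilon> / m" using g by (simp add: diff_divide_distrib)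
  moreover have "(norm (u - v))\<^sup>2 = 2 * (1 - u \<bullet> v)"
    using uv by (simp add: power2_norm_eq_inner inner_diff inner_commute norm_eq_1)
  ultimately have "(norm (u - v))\<^sup>2 \<le> 4 * L * \<epsilon> / m" by simp
  then have "norm (u - v) \<le> sqrt (4 * L * \<epsilon> / m)" by (rule real_le_rsqrt)
  moreover have "S x - x - \<tau> *\<^sub>R g = s *\<^sub>R (u - v)"
    using s0 by (simp add: u_def v_def \<tau> scaleR_diff_right)
  ultimately have "norm (S x - x - \<tau> *\<^sub>R g) \<le> s * sqrt (4 * L * \<epsilon> / m)"
    using s0 by simp
  also have "\<dots> = \<tau> * (norm g * sqrt (4 * L * \<epsilon> / m))" using g by (simp add: \<tau>)
  also have "\<dots> \<le> \<tau> * (M * sqrt (4 * L * \<epsilon> / m))"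
    using g s0 L_pos \<epsilon> m by (intro mult_left_mono mult_right_mono) (auto simp: \<tau>)
  finally show "norm (S x - x - \<tau> *\<^sub>R gradient f x) \<le> \<tau> * (M * sqrt (4 * L * \<epsilon> / m))"
    by (simp add: g_def)
qed

text \<open>Local error per unit of time: the first term comes from the deviation of the shift from the
  Euler step, the second from the deviation of the flow from it.\<close>

definition tracking_rate :: "real \<Rightarrow> real \<Rightarrow> real" where
  "tracking_rate m \<epsilon> = M * sqrt (4 * L * \<epsilon> / m) + L * M * (\<epsilon> / m)"

text \<open>With \<open>\<rho>\<close> the local error rate, the error after time \<open>t\<close> is at most \<open>E(t) = \<rho> (exp(L t) - 1) / L\<close>,
  because \<open>E\<close> absorbs a step: \<open>(1 + L \<tau>) E(t) + \<tau> \<rho> \<le> E(t + \<tau>)\<close>. The hypotheses keep \<open>E\<close> below \<open>\<delta>\<close> up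
  to time \<open>T\<close>. The remaining \<open>\<delta>\<close> in the radius of the tube has two uses: the \<open>\<epsilon>\<close>-balls around
  the iterates contain no critical point, and at the last clock time before \<open>T\<close> the
  flow is within \<open>\<delta>\<close> of \<open>\<gamma> T\<close>.\<close>

lemma shift_tracks_flow:
  assumes flow: "gradient_flow_line f x \<gamma>" and T: "0 \<le> T"
    and tube: "\<And>t z. 0 \<le> t \<Longrightarrow> t \<le> T \<Longrightarrow> norm (z - \<gamma> t) \<le> 2 * \<delta> \<Longrightarrow> m \<le> norm (gradient f z)"
    and m: "0 < m" and \<delta>: "0 < \<delta>"
    and S: "max_slope_shift_map f \<epsilon> c S" and \<epsilon>: "0 < \<epsilon>" "\<epsilon> \<le> \<delta>" and c: "0 < c" "c < 1"
    and small: "tracking_rate m \<epsilon> / L * exp (L * T) \<le> \<delta>" "M * (\<epsilon> / m) \<le> \<delta>"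
  shows "\<exists>k. (\<forall>j<k. \<not> local_max_near f \<epsilon> ((S ^^ j) x)) \<and> norm ((S ^^ k) x - \<gamma> T) \<le> 2 * \<delta>"
proof -
  define \<rho> where "\<rho> = tracking_rate m \<epsilon>"
  have \<rho>: "0 \<le> \<rho>" using L_pos M_pos \<epsilon> m by (simp add: \<rho>_def tracking_rate_def)
  define E where "E t = \<rho> / L * (exp (L * t) - 1)" for t
  define P where "P k \<longleftrightarrow> (\<exists>t. 0 \<le> t \<and> t \<le> T \<and> real k * (c * \<epsilon> / M) \<le> t \<and>
      norm ((S ^^ k) x - \<gamma> t) \<le> E t \<and> (\<forall>j<k. \<not> local_max_near f \<epsilon> ((S ^^ j) x)))" for k
  have E_le: "E t \<le> \<delta>" if "t \<le> T" for t
  proof -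
    have "exp (L * t) - 1 \<le> exp (L * T)" using that L_pos
      by (smt (verit) exp_le_cancel_iff mult_left_mono)
    then have "E t \<le> \<rho> / L * exp (L * T)" unfolding E_def
      using \<rho> L_pos by (intro mult_left_mono) auto
    then show ?thesis using small(1) by (simp add: \<rho>_def)
  qed
  have "P 0"
    using flow T unfolding P_def by (intro exI[of _ 0]) (auto simp: gradient_flow_line_def E_def)
  have step: "0 < c * \<epsilon> / M" using c \<epsilon> M_pos by simp
  then obtain n where "T < real n * (c * \<epsilon> / M)" using reals_Archimedean3 by blast
  then have "\<not> P n" by (auto simp: P_def)
  (* Iterate k is the last one whose clock time t does not exceed T. *)
  obtain k where k: "P k" "\<not> P (Suc k)" using \<open>P 0\<close> \<open>\<not> P n\<close> by (metis nat_induct)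
  define y where "y = (S ^^ k) x"
  obtain t where t: "0 \<le> t" "t \<le> T" "real k * (c * \<epsilon> / M) \<le> t" "norm (y - \<gamma> t) \<le> E t"
      "\<forall>j<k. \<not> local_max_near f \<epsilon> ((S ^^ j) x)"
    using k(1) by (auto simp: P_def y_def)
  have y\<delta>: "norm (y - \<gamma> t) \<le> \<delta>" using t(4) E_le[OF t(2)] by simp
  have nn: "\<not> local_max_near f \<epsilon> y"
  proof
    assume "local_max_near f \<epsilon> y"
    then obtain z where z: "dist y z < \<epsilon>" "is_local_max f z" by (auto simp: local_max_near_def)
    have "dist z (\<gamma> t) \<le> dist y z + dist y (\<gamma> t)" by (metis dist_commute dist_triangle)
    then have "norm (z - \<gamma> t) \<le> 2 * \<delta>" using z(1) y\<delta> \<epsilon> by (simp add: dist_norm)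
    then show False using tube[OF t(1,2)] local_max_critical[OF z(2)] m by force
  qed
  have gy: "m \<le> norm (gradient f y)" using tube[OF t(1,2), of y] y\<delta> \<delta> by simp
  define \<tau> where "\<tau> = norm (S y - y) / norm (gradient f y)"
  note eu = shift_euler[OF S nn \<epsilon>(1) c m gy, folded \<tau>_def]
  have \<tau>: "0 \<le> \<tau>" by (simp add: \<tau>_def)
  have "norm (S y - \<gamma> (t + \<tau>)) \<le> E (t + \<tau>)"
  proof -
    define r1 r2 where "r1 = S y - y - \<tau> *\<^sub>R gradient f y"
      and "r2 = \<gamma> (t + \<tau>) - \<gamma> t - \<tau> *\<^sub>R gradient f (\<gamma> t)"
    have r2: "norm r2 \<le> \<tau> * (L * M * (\<epsilon> / m))"
    proof -
      have "norm r2 \<le> L * M * \<tau>\<^sup>2" unfolding r2_def by (rule flow_line_euler[OF flow t(1) \<tau>])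
      also have "\<dots> = \<tau> * (L * M * \<tau>)" by (simp add: power2_eq_square)
      also have "\<dots> \<le> \<tau> * (L * M * (\<epsilon> / m))"
        using eu(3) \<tau> L_pos M_pos by (intro mult_left_mono) auto
      finally show ?thesis .
    qed
    have r1: "norm r1 \<le> \<tau> * (M * sqrt (4 * L * \<epsilon> / m))" using eu(1) by (simp add: r1_def)
    have r12: "norm r1 + norm r2 \<le> \<tau> * \<rho>"
      using r1 r2 by (simp add: \<rho>_def tracking_rate_def distrib_left)
    have "S y - \<gamma> (t + \<tau>) = (y - \<gamma> t) + \<tau> *\<^sub>R (gradient f y - gradient f (\<gamma> t)) + (r1 - r2)"
      by (simp add: r1_def r2_def algebra_simps)
    also have "norm \<dots> \<le> norm (y - \<gamma> t) + norm (\<tau> *\<^sub>R (gradient f y - gradient f (\<gamma> t))) + norm (r1 - r2)"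
      by (intro norm_triangle_mono order_refl)
    also have "\<dots> \<le> norm (y - \<gamma> t) + \<tau> * (L * norm (y - \<gamma> t)) + \<tau> * \<rho>"
      using \<tau> lip[of y "\<gamma> t"] r12 norm_triangle_ineq4[of r1 r2]
      by (intro add_mono order_refl) (auto intro: mult_left_mono)
    also have "\<dots> = (1 + L * \<tau>) * norm (y - \<gamma> t) + \<tau> * \<rho>" by (simp add: algebra_simps)
    also have "\<dots> \<le> (1 + L * \<tau>) * E t + \<tau> * \<rho>"
      using t(4) L_pos \<tau> by (intro add_mono mult_left_mono) auto
    also have "\<dots> = \<rho> / L * ((1 + L * \<tau>) * exp (L * t) - 1)"
      using L_pos by (simp add: E_def field_simps)
    also have "\<dots> \<le> \<rho> / L * (exp (L * \<tau>) * exp (L * t) - 1)"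
      using \<rho> L_pos exp_ge_add_one_self[of "L * \<tau>"]
      by (intro mult_left_mono diff_mono mult_right_mono) auto
    also have "\<dots> = E (t + \<tau>)" by (simp add: E_def exp_add[symmetric] algebra_simps)
    finally show ?thesis .
  qed
  moreover have "real (Suc k) * (c * \<epsilon> / M) \<le> t + \<tau>"
    using t(3) eu(2) unfolding of_nat_Suc distrib_right by simp
  moreover have "\<forall>j<Suc k. \<not> local_max_near f \<epsilon> ((S ^^ j) x)"
    using t(5) nn by (auto simp: less_Suc_eq y_def)
  ultimately have "\<not> t + \<tau> \<le> T"
    using k(2) t(1) \<tau> unfolding P_def y_def
    by (metis add_nonneg_nonneg comp_apply funpow.simps(2))
  have "norm (\<gamma> t - \<gamma> T) \<le> M * \<bar>t - T\<bar>" by (rule flow_line_lipschitz[OF flow t(1) T])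
  also have "\<dots> \<le> M * (\<epsilon> / m)"
    using \<open>\<not> t + \<tau> \<le> T\<close> eu(3) t(2) M_pos by (intro mult_left_mono) auto
  also have "\<dots> \<le> \<delta>" by (rule small(2))
  finally have "norm (y - \<gamma> T) \<le> 2 * \<delta>"
    using y\<delta> norm_triangle_ineq[of "y - \<gamma> t" "\<gamma> t - \<gamma> T"] by simp
  then show ?thesis using t(5) by (auto simp: y_def)
qed

lemma eventually_tracking_rate_small:
  assumes "0 < K"
  shows "\<forall>\<^sub>F \<epsilon> in at_right 0. tracking_rate m \<epsilon> / L * C < K"
proof (rule order_tendstoD)
  show "((\<lambda>\<epsilon>. tracking_rate m \<epsilon> / L * C) \<longlongrightarrow> (M * sqrt (4 * L * 0 / m) + L * M * (0 / m)) / L * C) (at_right 0)"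
    unfolding tracking_rate_def by (auto simp: divide_inverse intro!: tendsto_eq_intros)
qed (use assms in simp)

lemma flow_line_tube:
  assumes flow: "gradient_flow_line f x \<gamma>" and T: "0 \<le> T"
    and nz: "\<And>t. 0 \<le> t \<Longrightarrow> t \<le> T \<Longrightarrow> gradient f (\<gamma> t) \<noteq> 0"
  obtains m \<delta> where "0 < m" "0 < \<delta>"
    "\<And>t z. 0 \<le> t \<Longrightarrow> t \<le> T \<Longrightarrow> norm (z - \<gamma> t) \<le> \<delta> \<Longrightarrow> m \<le> norm (gradient f z)"
proof -
  have "continuous_on {0..T} (\<lambda>t. norm (gradient f (\<gamma> t)))"
  proof (intro continuous_on_norm lipschitz_on_continuous_on[of "L * M"] lipschitz_onI)
    fix s t assume "s \<in> {0..T}" "t \<in> {0..T}"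
    then have "L * norm (\<gamma> s - \<gamma> t) \<le> L * (M * \<bar>s - t\<bar>)"
      using flow_line_lipschitz[OF flow] L_pos by (intro mult_left_mono) auto
    then show "dist (gradient f (\<gamma> s)) (gradient f (\<gamma> t)) \<le> L * M * dist s t"
      using lip[of "\<gamma> s" "\<gamma> t"] by (simp add: dist_norm mult.assoc)
  qed (use L_pos M_pos in simp)
  then obtain t0 where t0: "t0 \<in> {0..T}"
      "\<And>t. t \<in> {0..T} \<Longrightarrow> norm (gradient f (\<gamma> t0)) \<le> norm (gradient f (\<gamma> t))"
    using continuous_attains_inf[of "{0..T}"] T by fastforce
  define m where "m = norm (gradient f (\<gamma> t0)) / 2"
  have "0 < m" using nz t0(1) by (simp add: m_def)
  moreover have "m \<le> norm (gradient f z)"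
    if "0 \<le> t" "t \<le> T" "norm (z - \<gamma> t) \<le> m / L" for t z
  proof -
    have "norm (gradient f z - gradient f (\<gamma> t)) \<le> L * (m / L)"
      using that(3) lip[of z "\<gamma> t"] L_pos by (meson mult_left_mono order_trans less_imp_le)
    then have "norm (gradient f z - gradient f (\<gamma> t)) \<le> m" using L_pos by simp
    moreover have "2 * m \<le> norm (gradient f (\<gamma> t))" using t0(2)[of t] that by (simp add: m_def)
    ultimately show ?thesis
      using norm_triangle_ineq2[of "gradient f (\<gamma> t)" "gradient f z"] by (simp add: norm_minus_commute)
  qed
  ultimately show ?thesis using that[of m "m / L"] L_pos by auto
qed

lemma converges_shift_start:
  assumes "\<forall>j<k. \<not> local_max_near f \<epsilon> ((S ^^ j) x)"
    and "max_slope_shift_converges f \<epsilon> S ((S ^^ k) x) z"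
  shows "max_slope_shift_converges f \<epsilon> S x z"
proof -
  obtain n where n: "\<forall>j<n. \<not> local_max_near f \<epsilon> ((S ^^ j) ((S ^^ k) x))"
      "local_max_near f \<epsilon> ((S ^^ n) ((S ^^ k) x))" "(S ^^ Suc n) ((S ^^ k) x) = z"
    using assms(2) by (auto simp: max_slope_shift_converges_def)
  have add: "(S ^^ j) ((S ^^ k) x) = (S ^^ (j + k)) x" for j by (simp add: funpow_add)
  have "\<not> local_max_near f \<epsilon> ((S ^^ j) x)" if "j < n + k" for j
  proof (cases "j < k")
    case False
    then have "j - k < n" "j - k + k = j" using that by auto
    then show ?thesis using n(1) add[of "j - k"] by metis
  qed (use assms(1) in blast)
  then show ?thesis unfolding max_slope_shift_converges_def
    using n(2,3) add[of n] by (intro exI[of _ "n + k"]) auto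
qed

text \<open>If \<open>x0\<close> is the mode itself, capture alone suffices: the flow line is constant and has no tube on
  which the gradient is bounded below. Otherwise all points of the flow line are regular, since a
  critical one would make it constant and equal to its limit.\<close>

theorem shift_consistent:
  assumes xs: "is_local_max f xs" and iso: "\<forall>\<^sub>F x in at xs. gradient f x \<noteq> 0"
    and c: "0 < c" "c < 1" and x0: "x0 \<in> basin f xs"
  shows "\<exists>\<epsilon>0>0. \<forall>\<epsilon>\<in>{0<..\<epsilon>0}. \<forall>S. max_slope_shift_map f \<epsilon> c S \<longrightarrow>
           max_slope_shift_converges f \<epsilon> S x0 xs"
proof -
  obtain U e where U: "open U" "xs \<in> U" "0 < e" and trap:
    "\<And>\<epsilon> S x. 0 < \<epsilon> \<Longrightarrow> \<epsilon> \<le> e \<Longrightarrow> max_slope_shift_map f \<epsilon> c S \<Longrightarrow> x \<in> U \<Longrightarrow>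
       max_slope_shift_converges f \<epsilon> S x xs"
    using trapping_neighbourhood[OF xs iso c] by metis
  show ?thesis
  proof (cases "x0 = xs")
    case True
    then show ?thesis using trap U by (intro exI[of _ e]) auto
  next
    case False
    obtain \<gamma> where flow: "gradient_flow_line f x0 \<gamma>" and lim: "(\<gamma> \<longlongrightarrow> xs) at_top"
      using x0 by (auto simp: basin_def)
    have nz: "gradient f (\<gamma> t) \<noteq> 0" if "0 \<le> t" for t
    proof
      assume "gradient f (\<gamma> t) = 0"
      then have const: "\<gamma> s = \<gamma> t" if "0 \<le> s" for s
        using flow_line_at_critical_point[OF flow \<open>0 \<le> t\<close> _ that] by simp
      have "\<forall>\<^sub>F s in at_top. \<gamma> s = \<gamma> t"
        using eventually_ge_at_top[of 0] by eventually_elim (rule const)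
      then have "(\<gamma> \<longlongrightarrow> \<gamma> t) at_top" by (rule tendsto_eventually)
      then have "\<gamma> t = xs" using lim by (intro tendsto_unique[OF trivial_limit_at_top_linorder])
      then show False using const[of 0] flow False by (simp add: gradient_flow_line_def)
    qed
    have "\<forall>\<^sub>F t in at_top. 0 \<le> t \<and> \<gamma> t \<in> U"
      using eventually_ge_at_top[of 0] topological_tendstoD[OF lim U(1,2)] by eventually_elim simp
    then obtain T where T: "0 \<le> T" "\<gamma> T \<in> U" by (auto simp: eventually_at_top_linorder)
    obtain m \<delta>1 where m: "0 < m" "0 < \<delta>1"
        and tube: "\<And>t z. 0 \<le> t \<Longrightarrow> t \<le> T \<Longrightarrow> norm (z - \<gamma> t) \<le> \<delta>1 \<Longrightarrow> m \<le> norm (gradient f z)"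
      using flow_line_tube[OF flow T(1) nz] by metis
    obtain \<delta>2 where \<delta>2: "0 < \<delta>2" "cball (\<gamma> T) \<delta>2 \<subseteq> U"
      using U(1) T(2) open_contains_cball by metis
    define \<delta> where "\<delta> = min \<delta>1 \<delta>2 / 2"
    have \<delta>: "0 < \<delta>" "2 * \<delta> \<le> \<delta>1" "2 * \<delta> \<le> \<delta>2" using m \<delta>2 by (auto simp: \<delta>_def)
    obtain b where b: "0 < b"
        "\<And>\<epsilon>. 0 < \<epsilon> \<Longrightarrow> \<epsilon> < b \<Longrightarrow> tracking_rate m \<epsilon> / L * exp (L * T) < \<delta>"
      using eventually_tracking_rate_small[OF \<delta>(1), of m "exp (L * T)"]
      unfolding eventually_at_right_field by blast
    define \<epsilon>0 where "\<epsilon>0 = min (min e (b / 2)) (min \<delta> (\<delta> * m / M))"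
    show ?thesis
    proof (intro exI[of _ \<epsilon>0] conjI ballI allI impI)
      show "0 < \<epsilon>0" using U(3) b(1) \<delta>(1) m(1) M_pos by (simp add: \<epsilon>0_def)
      fix \<epsilon> S assume "\<epsilon> \<in> {0<..\<epsilon>0}" and S: "max_slope_shift_map f \<epsilon> c S"
      then have \<epsilon>: "0 < \<epsilon>" "\<epsilon> \<le> e" "\<epsilon> < b" "\<epsilon> \<le> \<delta>" "\<epsilon> \<le> \<delta> * m / M"
        using b(1) by (auto simp: \<epsilon>0_def)
      have "M * (\<epsilon> / m) \<le> \<delta>" using \<epsilon>(5) m(1) M_pos by (simp add: field_simps)
      then have "\<exists>k. (\<forall>j<k. \<not> local_max_near f \<epsilon> ((S ^^ j) x0)) \<and> norm ((S ^^ k) x0 - \<gamma> T) \<le> 2 * \<delta>"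
        using \<delta> by (intro shift_tracks_flow[OF flow T(1) tube m(1) \<delta>(1) S \<epsilon>(1,4) c
            less_imp_le[OF b(2)[OF \<epsilon>(1,3)]]]) auto
      then obtain k where k: "\<forall>j<k. \<not> local_max_near f \<epsilon> ((S ^^ j) x0)"
          "norm ((S ^^ k) x0 - \<gamma> T) \<le> 2 * \<delta>" by blast
      have "(S ^^ k) x0 \<in> U"
        using k(2) \<delta>(3) \<delta>2(2) by (auto simp: dist_norm norm_minus_commute)
      then show "max_slope_shift_converges f \<epsilon> S x0 xs"
        by (intro converges_shift_start[OF k(1)] trap[OF \<epsilon>(1,2) S])
    qed
  qed
qed

end

section \<open>Gradient and Hessian\<close>

lemma has_derivative_gradient:
  fixes f :: "'a::euclidean_space \<Rightarrow> real"
  assumes "f differentiable (at x)"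
  shows "(f has_derivative (\<lambda>h. h \<bullet> gradient f x)) (at x)"
proof -
  obtain F where F: "(f has_derivative F) (at x)" using assms by (auto simp: differentiable_def)
  interpret F: linear F using F has_derivative_linear by blast
  have "F = (\<lambda>h. h \<bullet> (\<Sum>b\<in>Basis. F b *\<^sub>R b))"
  proof
    fix h
    have "F h = F (\<Sum>b\<in>Basis. (h \<bullet> b) *\<^sub>R b)" by (simp add: euclidean_representation)
    then show "F h = h \<bullet> (\<Sum>b\<in>Basis. F b *\<^sub>R b)"
      by (simp add: F.sum F.scaleR inner_sum_right mult.commute)
  qed
  with F have "GDERIV f x :> (\<Sum>b\<in>Basis. F b *\<^sub>R b)" by (simp add: gderiv_def)
  moreover have "D = D'" if "GDERIV f x :> D" "GDERIV f x :> D'" for D D'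
  proof -
    have "(\<lambda>h. h \<bullet> D) = (\<lambda>h. h \<bullet> D')"
      using that unfolding gderiv_def by (rule has_derivative_unique)
    then show ?thesis by (metis inner_commute vector_eq_rdot)
  qed
  ultimately have "GDERIV f x :> gradient f x" unfolding gradient_def by (metis theI)
  then show ?thesis by (simp add: gderiv_def)
qed

lemma has_derivative_hessian:
  assumes "gradient f differentiable (at x)"
  shows "(gradient f has_derivative blinfun_apply (hessian f x)) (at x)"
  using assms unfolding hessian_def
  by (simp add: bounded_linear_Blinfun_apply frechet_derivative_works
      has_derivative_bounded_linear)

text \<open>An injective linear map on a finite-dimensional space is bounded below, so near \<open>x\<close> the linear
  part of the increment of \<open>g\<close> dominates the remainder.\<close>

lemma isolated_value_if_inj_derivative:
  fixes g :: "'a::euclidean_space \<Rightarrow> 'b::euclidean_space"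
  assumes g: "(g has_derivative D) (at x)" and "inj D"
  shows "\<forall>\<^sub>F y in at x. g y \<noteq> g x"
proof -
  obtain B where B: "0 < B" "\<And>h. B * norm h \<le> norm (D h)"
    using linear_inj_bounded_below_pos[OF has_derivative_linear[OF g] \<open>inj D\<close>] by blast
  have "0 < B / 2" using B by simp
  then obtain d where d: "0 < d"
      "\<And>y. norm (y - x) < d \<Longrightarrow> norm (g y - g x - D (y - x)) \<le> B / 2 * norm (y - x)"
    using g unfolding has_derivative_at_alt by blast
  have "g y \<noteq> g x" if "y \<noteq> x" "norm (y - x) < d" for y
  proof
    assume "g y = g x"
    then have "norm (D (y - x)) \<le> B / 2 * norm (y - x)" using d(2)[OF that(2)] by simp
    with B(2)[of "y - x"] have "B * norm (y - x) \<le> 0" by simp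
    then show False using B(1) that(1) by (simp add: mult_le_0_iff)
  qed
  then show ?thesis unfolding eventually_at using d(1) by (auto simp: dist_norm)
qed

section \<open>Consistency\<close>

theorem mainTheorem4:
  fixes f :: "'a::euclidean_space \<Rightarrow> real" and c :: real
  assumes "probability_density f"
    and "(f \<longlongrightarrow> 0) at_infinity"
    and "twice_differentiable f"
    and "bounded (range f)" and "uniformly_continuous_on UNIV f"
    and "bounded (range (gradient f))" and "uniformly_continuous_on UNIV (gradient f)"
    and "bounded (range (hessian f))" and "uniformly_continuous_on UNIV (hessian f)"
    and "\<And>x. critical_point f x \<Longrightarrow> bij (blinfun_apply (hessian f x))"
    and "0 < c" and "c < 1"
  shows "\<forall>x_star x0. is_local_max f x_star \<and> x0 \<in> basin f x_star \<longrightarrow>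
    (\<exists>\<epsilon>0>0. \<forall>\<epsilon>\<in>{0<..\<epsilon>0}. \<forall>S. max_slope_shift_map f \<epsilon> c S \<longrightarrow>
       max_slope_shift_converges f \<epsilon> S x0 x_star)"
proof -
  have g: "(f has_derivative (\<lambda>h. h \<bullet> gradient f x)) (at x)"
    and H: "(gradient f has_derivative blinfun_apply (hessian f x)) (at x)" for x
    using assms(3) by (auto simp: twice_differentiable_def intro: has_derivative_gradient
        has_derivative_hessian)
  obtain L where L: "0 < L" "\<And>x. norm (hessian f x) \<le> L"
    using assms(8) unfolding bounded_pos by auto
  obtain M where M: "0 < M" "\<And>x. norm (gradient f x) \<le> M"
    using assms(6) unfolding bounded_pos by auto
  have "norm (gradient f x - gradient f y) \<le> L * norm (x - y)" for x y
    by (rule differentiable_bound[of UNIV _ "\<lambda>x. blinfun_apply (hessian f x)"])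
      (use H L(2) in \<open>auto simp: norm_blinfun.rep_eq[symmetric]\<close>)
  then interpret lipschitz_gradient f L M
    using g L(1) M by unfold_locales auto
  show ?thesis
  proof (intro allI impI, elim conjE)
    fix x_star x0 assume xs: "is_local_max f x_star" and x0: "x0 \<in> basin f x_star"
    have crit: "gradient f x_star = 0" by (rule local_max_critical[OF xs])
    then have "inj (blinfun_apply (hessian f x_star))"
      using assms(10) by (simp add: critical_point_def bij_is_inj)
    then have "\<forall>\<^sub>F x in at x_star. gradient f x \<noteq> 0"
      using isolated_value_if_inj_derivative[OF H] crit by metis
    then show "\<exists>\<epsilon>0>0. \<forall>\<epsilon>\<in>{0<..\<epsilon>0}. \<forall>S. max_slope_shift_map f \<epsilon> c S \<longrightarrow>
       max_slope_shift_converges f \<epsilon> S x0 x_star"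
      by (rule shift_consistent[OF xs _ assms(11,12) x0])
  qed
qed

end
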